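(* For the cycle graph $C_n$, the spectrum of the diminished Sombor matrix $M_{DS}(C_n)$ is $$\left\{\sqrt2\cos\left(\frac{2\pi j}{n}\right)\ \middle|\ j=0,1,\dots,n-1\right\}$$ (as a multiset of eigenvalues).
   Context: $C_n$ is the cycle on $n$ vertices ($n\geq3$). For a finite simple graph $G$ with vertices $v_1,\dots,v_n$ and degrees $d_i=d_{v_i}$, the diminished Sombor matrix $M_{DS}(G)=(\mu_{ij})$ is the $n\times n$ real symmetric matrix with $\mu_{ij}=\frac{\sqrt{d_i^2+d_j^2}}{d_i+d_j}$ if $v_iv_j\in E(G)$, and $\mu_{ij}=0$ otherwise. *)

theory Defs
  imports
    Complex_Main
    "Graph_Theory.Pair_Digraph"
    "Jordan_Normal_Form.Char_Poly"
begin

text \<open>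
  A finite simple graph is a \<^locale>\<open>pair_graph\<close>: finite, loop-free, without parallel arcs, and
  symmetric. An undirected edge \<open>uv\<close> is the pair of arcs \<open>(u, v)\<close>, \<open>(v, u)\<close>, so the degree of a
  vertex is its out-degree.
\<close>

definition cycle_graph :: "nat \<Rightarrow> nat pair_pre_digraph" where
  "cycle_graph n =
     \<lparr> pverts = {..<n},
       parcs = {(i, j). i < n \<and> j < n \<and> (j = Suc i mod n \<or> i = Suc j mod n)} \<rparr>"

text \<open>For \<open>n < 3\<close> the definition does not describe a cycle (for \<open>n = 1\<close> it has a loop).\<close>

lemma pair_graph_cycle_graph:
  assumes "n \<ge> 3"
  shows "pair_graph (cycle_graph n)"
proof -
  have "finite {(i, j). i < n \<and> j < n \<and> (j = Suc i mod n \<or> i = Suc j mod n)}"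
    by (rule finite_subset[of _ "{..<n} \<times> {..<n}"]) auto
  moreover have "i \<noteq> Suc i mod n" if "i < n" for i
    using assms that by (cases "Suc i = n") auto
  ultimately show ?thesis
    by unfold_locales (fastforce simp: cycle_graph_def symmetric_def intro!: symI)+
qed

lemma out_degree_cycle_graph:
  assumes "n \<ge> 3" "i < n"
  shows "out_degree (with_proj (cycle_graph n)) i = 2"
proof -
  define p where "p = (if i = 0 then n - 1 else i - 1)"
  have pred: "i = Suc j mod n \<longleftrightarrow> j = p" if "j < n" for j
    using assms that unfolding p_def by (cases "Suc j = n") auto
  have "p < n" "p \<noteq> Suc i mod n"
    using assms unfolding p_def by (cases "Suc i = n"; auto)+
  moreover have "out_arcs (with_proj (cycle_graph n)) i = {(i, Suc i mod n), (i, p)}"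
  proof -
    have "out_arcs (with_proj (cycle_graph n)) i =
        Pair i ` {j. j < n \<and> (j = Suc i mod n \<or> i = Suc j mod n)}"
      using assms by (auto simp: out_arcs_def cycle_graph_def)
    also have "{j. j < n \<and> (j = Suc i mod n \<or> i = Suc j mod n)} = {Suc i mod n, p}"
      using assms \<open>p < n\<close> pred[OF \<open>p < n\<close>] by (auto dest: pred[THEN iffD1, rotated])
    finally show ?thesis by simp
  qed
  ultimately show ?thesis
    by (simp add: out_degree_def)
qed

text \<open>
  The list \<open>vs\<close> enumerates the vertices of \<open>G\<close> without repetition; it fixes the order of the rows
  and columns.
\<close>

definition diminished_Sombor_matrix :: "'a pair_pre_digraph \<Rightarrow> 'a list \<Rightarrow> real mat" where
  "diminished_Sombor_matrix G vs =
     mat (length vs) (length vs) (\<lambda>(i, j).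
       let d = (\<lambda>k. real (out_degree (with_proj G) (vs ! k)))
       in if (vs ! i, vs ! j) \<in> parcs G
          then sqrt ((d i)\<^sup>2 + (d j)\<^sup>2) / (d i + d j)
          else 0)"

text \<open>
  Eigenvalues with their algebraic multiplicities. For a real symmetric matrix all complex
  eigenvalues are real, so nothing is lost by taking the roots in the reals.
\<close>

definition spectrum_mset :: "real mat \<Rightarrow> real multiset" where
  "spectrum_mset A = proots (char_poly A)"

lemma set_spectrum_mset:
  assumes "A \<in> carrier_mat n n"
  shows "set_mset (spectrum_mset A) = {x. eigenvalue A x}"
proof -
  have "char_poly A \<noteq> 0"
    using degree_monic_char_poly[OF assms] by auto
  then show ?thesis
    by (simp add: spectrum_mset_def eigenvalue_root_char_poly[OF assms])
qed

end

theory Submission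
  imports Defs
begin

text \<open>
  Let \<open>z\<^sub>j = cis (2 * pi * j / n)\<close>. Every vertex has degree 2, so the matrix is \<open>1 / sqrt 2\<close> times the
  adjacency matrix, and the vector \<open>v \<mapsto> z\<^sub>j ^ v\<close> is an eigenvector for
  \<open>(z\<^sub>j + inverse z\<^sub>j) / sqrt 2 = sqrt 2 * cos (2 * pi * j / n)\<close>. The orthogonality relations make the
  matrix of these \<open>n\<close> vectors invertible, so over the complex numbers the matrix is similar to the
  diagonal matrix of these values; comparing characteristic polynomials gives the multiplicities.
\<close>

lemma power_mod_root_of_unity:
  fixes z :: "'a :: monoid_mult"
  assumes "z ^ n = 1"
  shows "z ^ (k mod n) = z ^ k"
proof -
  have "z ^ k = z ^ (n * (k div n) + k mod n)"
    by simp
  also have "\<dots> = z ^ (k mod n)"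
    by (simp only: power_add power_mult assms power_one mult_1_left)
  finally show ?thesis ..
qed

text \<open>For \<open>z\<close> other than 1 the closed form of the geometric sum has numerator
  \<open>1 - z ^ n\<close>, which vanishes. This supplies the orthogonality relations.\<close>

lemma sum_power_root_of_unity:
  fixes z :: "'a :: field"
  assumes "z ^ n = 1"
  shows "(\<Sum>k<n. z ^ k) = (if z = 1 then of_nat n else 0)"
  using assms by (simp add: sum_gp_strict)

text \<open>The predecessor is written \<open>(u + n - 1) mod n\<close> because \<open>u - 1\<close>
  would truncate at \<open>u = 0\<close>. With both neighbours given as residues, powers of a root
  of unity can drop the \<open>mod\<close>.\<close>

lemma parcs_cycle_graph_iff:
  assumes "u < n"
  shows "(u, v) \<in> parcs (cycle_graph n) \<longleftrightarrow> v \<in> {Suc u mod n, (u + n - 1) mod n}"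
proof -
  have "v < n \<and> u = Suc v mod n \<longleftrightarrow> v = (u + n - 1) mod n"
  proof (cases "u = 0")
    case True
    then show ?thesis
      using assms by (auto simp: mod_Suc split: if_splits)
  next
    case False
    then have "(u + n - 1) mod n = u - 1"
      using assms by (metis Nat.add_diff_assoc2 Suc_leI bot_nat_0.not_eq_extremum less_imp_diff_less
          mod_add_self2 mod_less One_nat_def)
    then show ?thesis
      using assms False by (auto simp: mod_Suc)
  qed
  then show ?thesis
    using assms by (auto simp: cycle_graph_def)
qed

text \<open>If the neighbours coincided, their successors \<open>u + 2\<close> and
  \<open>u + n\<close> would be congruent modulo \<open>n\<close>, forcing \<open>n dvd 2\<close>.
  Distinctness ensures that a sum over the neighbours has two terms.\<close>

lemma cycle_graph_neighbours_distinct: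
  assumes "n \<ge> 3" "u < n"
  shows "Suc u mod n \<noteq> (u + n - 1) mod n"
proof
  assume eq: "Suc u mod n = (u + n - 1) mod n"
  have "(u + 2) mod n = Suc (Suc u mod n) mod n"
    by (simp add: mod_simps)
  also have "\<dots> = (u + n) mod n"
    using assms by (simp add: eq mod_simps)
  finally have "n dvd 2"
    by (metis add_cancel_right_right diff_add_inverse mod_add_self2 mod_eq_dvd_iff_nat le_add1)
  then show False
    using assms by (auto dest: dvd_imp_le)
qed

text \<open>This is the eigenvector equation for the adjacency matrix: stepping to the successor
  multiplies by \<open>z\<close>, stepping to the predecessor by \<open>inverse z\<close>, and
  wrapping around costs nothing since \<open>z ^ n = 1\<close>.\<close>

lemma sum_cycle_graph_neighbours:
  fixes z :: "'a :: field"
  assumes "n \<ge> 3" "u < n" "z ^ n = 1"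
  shows "(\<Sum>v<n. if (u, v) \<in> parcs (cycle_graph n) then z ^ v else 0) = z ^ u * (z + inverse z)"
proof -
  have z0: "z \<noteq> 0"
    using assms by (auto simp: power_0_left)
  have "(\<Sum>v<n. if (u, v) \<in> parcs (cycle_graph n) then z ^ v else 0)
      = (\<Sum>v\<in>{Suc u mod n, (u + n - 1) mod n}. z ^ v)"
    using assms
    by (intro sum.mono_neutral_cong_right) (auto simp: parcs_cycle_graph_iff)
  also have "\<dots> = z ^ Suc u + z ^ (u + n - 1)"
    using cycle_graph_neighbours_distinct[OF assms(1,2)]
    by (simp add: power_mod_root_of_unity[OF assms(3)] del: power_Suc)
  also have "z ^ (u + n - 1) = z ^ u * inverse z"
  proof -
    have "z ^ (u + n - 1) * z = z ^ (u + n)"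
      using assms by (metis One_nat_def Suc_pred add_gr_0 less_le_trans mult.commute
          numeral_3_eq_3 power_Suc zero_less_Suc)
    then show ?thesis
      using z0 by (simp add: power_add assms field_simps)
  qed
  finally show ?thesis
    by (simp add: algebra_simps)
qed

lemma diminished_Sombor_matrix_cycle_graph:
  assumes "n \<ge> 3" "set vs = {..<n}"
  shows "diminished_Sombor_matrix (cycle_graph n) vs =
    mat (length vs) (length vs)
      (\<lambda>(i, j). if (vs ! i, vs ! j) \<in> parcs (cycle_graph n) then 1 / sqrt 2 else 0)"
proof -
  have deg: "out_degree (with_proj (cycle_graph n)) (vs ! i) = 2" if "i < length vs" for i
    using assms(2) nth_mem[OF that] by (intro out_degree_cycle_graph assms(1)) simp
  \<comment> \<open>Both sides are nonnegative with square 1/2.\<close>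
  have "sqrt (2\<^sup>2 + 2\<^sup>2) / (2 + 2) = 1 / sqrt (2::real)"
    by (rule power2_eq_imp_eq) (simp_all add: power_divide)
  then show ?thesis
    unfolding diminished_Sombor_matrix_def Let_def by (intro cong_mat) (simp_all add: deg)
qed

text \<open>The columns of \<open>P\<close> are eigenvectors, and \<open>P\<close> diagonalises
  \<open>A\<close>. The values \<open>d i\<close> may repeat, so algebraic multiplicities are
  captured.\<close>

lemma char_poly_eq_if_eigenvector_basis:
  fixes A :: "'a :: field mat"
  assumes A: "A \<in> carrier_mat n n" and P: "P \<in> carrier_mat n n" and Q: "Q \<in> carrier_mat n n"
    and QP: "Q * P = 1\<^sub>m n"
    and AP: "A * P = P * mat n n (\<lambda>(i, j). if i = j then d i else 0)"
  shows "char_poly A = (\<Prod>i<n. [:- d i, 1:])"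
proof -
  define D where "D = mat n n (\<lambda>(i, j). if i = j then d i else 0)"
  have D: "D \<in> carrier_mat n n"
    by (simp add: D_def)
  \<comment> \<open>For square matrices over a field a left inverse is also a right inverse, so
    computing \<open>Q * P\<close> suffices.\<close>
  have PQ: "P * Q = 1\<^sub>m n"
    by (rule mat_mult_left_right_inverse[OF Q P QP])
  have "A = A * (P * Q)"
    using A by (simp add: PQ)
  also have "\<dots> = P * D * Q"
    using A P Q by (simp add: AP D_def flip: assoc_mult_mat)
  finally have "similar_mat A D"
    using A P Q D PQ QP by (intro similar_matI[of _ _ P Q n]) auto
  then have "char_poly A = char_poly D"
    by (rule char_poly_similar)
  also have "\<dots> = (\<Prod>a\<leftarrow>diag_mat D. [:- a, 1:])"
    by (rule char_poly_upper_triangular[OF D]) (auto simp: D_def)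
  also have "diag_mat D = map d [0..<n]"
    by (auto simp: diag_mat_def D_def)
  finally show ?thesis
    by (simp add: comp_def atLeast0LessThan flip: prod.distinct_set_conv_list)
qed

theorem corollary3p3:
  fixes n :: nat and vs :: "nat list"
  assumes "n \<ge> 3"
    and "distinct vs" and "set vs = pverts (cycle_graph n)"
  shows "spectrum_mset (diminished_Sombor_matrix (cycle_graph n) vs) =
    {# sqrt 2 * cos (2 * pi * real j / real n). j \<in># mset_set {0..n - 1} #}"
proof -
  define A where "A = diminished_Sombor_matrix (cycle_graph n) vs"
  define A' where "A' = map_mat complex_of_real A"
  define z where "z j = cis (2 * pi * real j / real n)" for j
  define d where "d j = sqrt 2 * cos (2 * pi * real j / real n)" for j
  define P where "P = mat n n (\<lambda>(i, j). z j ^ (vs ! i))"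
  \<comment> \<open>Since \<open>z i\<close> lies on the unit circle, its inverse is its conjugate:
    \<open>Q\<close> is the conjugate transpose of \<open>P\<close> divided by
    \<open>n\<close>.\<close>
  define Q where "Q = mat n n (\<lambda>(i, j). inverse (z i) ^ (vs ! j) / of_nat n)"
  have vs: "set vs = {..<n}"
    using assms by (simp add: cycle_graph_def)
  have len: "length vs = n"
    using distinct_card[OF \<open>distinct vs\<close>] vs by simp
  have vs_less: "vs ! i < n" if "i < n" for i
    using that vs len by (auto dest: nth_mem)
  \<comment> \<open>Sums over matrix positions become sums over vertices, so the order chosen by
    \<open>vs\<close> is immaterial.\<close>
  have reindex: "(\<Sum>k = 0..<n. f (vs ! k)) = (\<Sum>v<n. f v)" for f :: "nat \<Rightarrow> complex"
    unfolding atLeast0LessThan using \<open>distinct vs\<close> len vs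
    by (intro sum.reindex_bij_betw bij_betw_nth) simp_all
  have A: "A = mat n n
      (\<lambda>(i, j). if (vs ! i, vs ! j) \<in> parcs (cycle_graph n) then 1 / sqrt 2 else 0)"
    unfolding A_def diminished_Sombor_matrix_cycle_graph[OF assms(1) vs] len ..
  have bij: "bij_betw z {..<n} {w. w ^ n = 1}"
    unfolding z_def using assms(1) by (intro bij_betw_roots_unity) simp
  have z_root: "z j ^ n = 1" if "j < n" for j
    using bij_betwE[OF bij] that by simp
  have z_nonzero: "z j \<noteq> 0" for j
    by (simp add: z_def)
  have eigenvalue: "(z j + inverse (z j)) / sqrt 2 = of_real (d j)" for j
  proof -
    \<comment> \<open>The sum of \<open>z j\<close> and its conjugate is twice the cosine, and
      \<open>2 = sqrt 2 * sqrt 2\<close>.\<close>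
    have "z j + inverse (z j) = complex_of_real (sqrt 2 * d j)"
      by (simp add: z_def d_def complex_eq_iff flip: mult.assoc)
    then show ?thesis
      by simp
  qed
  have "Q * P = 1\<^sub>m n"
  proof (rule eq_matI)
    fix i j assume "i < dim_row (1\<^sub>m n :: complex mat)" "j < dim_col (1\<^sub>m n :: complex mat)"
    then have ij: "i < n" "j < n"
      by simp_all
    have "(Q * P) $$ (i, j) = (\<Sum>k = 0..<n. (inverse (z i) * z j) ^ (vs ! k)) / of_nat n"
      using ij by (simp add: P_def Q_def scalar_prod_def power_mult_distrib sum_divide_distrib)
    also have "(\<Sum>k = 0..<n. (inverse (z i) * z j) ^ (vs ! k))
        = (\<Sum>v<n. (inverse (z i) * z j) ^ v)"
      by (rule reindex)
    also have "\<dots> = (if inverse (z i) * z j = 1 then of_nat n else 0)"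
      using ij by (intro sum_power_root_of_unity) (simp add: power_mult_distrib z_root power_inverse)
    also have "inverse (z i) * z j = 1 \<longleftrightarrow> z j = z i"
      using z_nonzero[of i] by (metis left_inverse mult_left_cancel nonzero_imp_inverse_nonzero)
    \<comment> \<open>Distinct indices below \<open>n\<close> give distinct roots of unity.\<close>
    also have "\<dots> \<longleftrightarrow> i = j"
      using inj_on_eq_iff[OF bij_betw_imp_inj_on[OF bij], of j i] ij by auto
    finally show "(Q * P) $$ (i, j) = 1\<^sub>m n $$ (i, j)"
      using ij by auto
  qed (simp_all add: P_def Q_def)
  moreover have "A' * P = P * mat n n (\<lambda>(i, j). if i = j then complex_of_real (d i) else 0)"
  proof (rule eq_matI)
    fix i j
    assume "i < dim_row (P * mat n n (\<lambda>(i, j). if i = j then complex_of_real (d i) else 0))"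
      and "j < dim_col (P * mat n n (\<lambda>(i, j). if i = j then complex_of_real (d i) else 0))"
    then have ij: "i < n" "j < n"
      by (simp_all add: P_def)
    have "(A' * P) $$ (i, j) =
        (\<Sum>k = 0..<n. if (vs ! i, vs ! k) \<in> parcs (cycle_graph n) then z j ^ (vs ! k) else 0) / sqrt 2"
      using ij unfolding sum_divide_distrib
      by (auto simp: A A'_def P_def scalar_prod_def intro!: sum.cong)
    also have "(\<Sum>k = 0..<n. if (vs ! i, vs ! k) \<in> parcs (cycle_graph n) then z j ^ (vs ! k) else 0)
        = (\<Sum>v<n. if (vs ! i, v) \<in> parcs (cycle_graph n) then z j ^ v else 0)"
      by (rule reindex)
    also have "\<dots> = z j ^ (vs ! i) * (z j + inverse (z j))"
      using ij by (intro sum_cycle_graph_neighbours assms vs_less z_root)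
    also have "\<dots> / sqrt 2 = z j ^ (vs ! i) * of_real (d j)"
      by (simp flip: eigenvalue)
    also have "\<dots> = (P * mat n n (\<lambda>(i, j). if i = j then complex_of_real (d i) else 0)) $$ (i, j)"
      using ij by (simp add: P_def scalar_prod_def if_distrib sum.delta cong: if_cong)
    finally show "(A' * P) $$ (i, j) =
        (P * mat n n (\<lambda>(i, j). if i = j then complex_of_real (d i) else 0)) $$ (i, j)" .
  qed (simp_all add: A A'_def P_def)
  ultimately have "char_poly A' = (\<Prod>j<n. [:- complex_of_real (d j), 1:])"
    by (intro char_poly_eq_if_eigenvector_basis[of _ n P Q]) (simp_all add: A A'_def P_def Q_def)
  \<comment> \<open>The factorisation was found over the complex numbers; as all \<open>d j\<close>
    are real and the embedding of polynomials is injective, it descends to the reals.\<close>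
  interpret hom: map_poly_inj_idom_hom complex_of_real ..
  have "map_poly complex_of_real (char_poly A) = char_poly A'"
    unfolding A'_def by (rule of_real_hom.char_poly_hom[symmetric, of _ n]) (simp add: A)
  also have "\<dots> = map_poly complex_of_real (\<Prod>j<n. [:- d j, 1:])"
    unfolding \<open>char_poly A' = _\<close> by (simp add: hom.hom_prod)
  finally have "char_poly A = (\<Prod>j<n. [:- d j, 1:])"
    by (rule hom.injectivity)
  \<comment> \<open>Roots of a product add up as multisets, so equal values, such as those for
    \<open>j\<close> and \<open>n - j\<close>, are counted separately.\<close>
  then have "spectrum_mset A = (\<Sum>j<n. {#d j#})"
    by (simp add: spectrum_mset_def proots_prod)
  also have "\<dots> = image_mset d (mset_set {..<n})"
    by (induction n) (simp_all add: lessThan_Suc)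
  also have "{..<n} = {0..n - 1}"
    using assms(1) by auto
  finally show ?thesis
    by (simp add: A_def d_def)
qed

end
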